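(* (Failure probability bound, truncated log-normal diffusion.) Let $D$, $a$, $b$, $\mathcal N(a,b)$, $c$, $\beta_N$, $c_\beta$, and the random field $\nu$ with $\nu_{\min}$, $\underline\nu$ be as in the context, and put $\Gamma(\omega)=\sum_{j=1}^M|z_j(\omega)|\,\|\psi_j\|_{L^\infty(D)}$. Let $\bar N\ge1$ be a given actuator parameter. Then the failure probability satisfies $$\mathbb P\left[\nu_{\min}^2(\omega)\,\beta_{\bar N}\le3c^2\mathcal N^2(a,b)\right]\le\mathbb E\left[e^{\Gamma}\right]\left(\sqrt3\,c\,\mathcal N(a,b)\,\beta_{\bar N}^{-1/2}-\underline\nu\right)\le\mathbb E\left[e^{\Gamma}\right]\left(\left(\frac{3}{c_\beta}\right)^{1/2}c\,\mathcal N(a,b)\,\bar N^{-1}-\underline\nu\right),$$ where $\mathbb E[e^\Gamma]$ is finite. Here $\sqrt3\,c\,\mathcal N(a,b)\,\beta_{\bar N}^{-1/2}-\underline\nu\ge0$, since otherwise the failure inequality $\nu_{\min}^2(\omega)\beta_{\bar N}\le3c^2\mathcal N^2(a,b)$ cannot hold; and it is assumed, without loss of generality, that $\beta_{\bar N}^{1/2}(1+\underline\nu)\ge\sqrt3\,c\,\mathcal N(a,b)$ (recall that $\beta_N\to\infty$ as $N\to\infty$).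
   Context: $D=\prod_{n=1}^d(0,L_n)\subset\mathbb R^d$, $L_n>0$; $H=L^2(D;\mathbb R)$, $V=H_0^1(D;\mathbb R)$ with $\|v\|_V=\|\nabla v\|_{L^2(D)}$. $(\Omega,\mathcal F,\mathbb P)$ is a complete probability space. $a\in L^\infty((0,\infty);L^r(D;\mathbb R))$ with $r\ge d$, $b\in L^\infty((0,\infty)\times D;\mathbb R^d)$, $\mathcal N(a,b)=\|a\|_{L^\infty((0,\infty);L^r(D))}+\|b\|_{L^\infty((0,\infty)\times D;\mathbb R^d)}$. The constant $c>0$ depends only on $D$ and is such that $|\langle a(t)y,y\rangle_{V',V}|+|(b(t)y,\nabla y)_{H}|\le c\,\mathcal N(a,b)\|y\|_H\|y\|_V$ for all $y\in V$ and a.e. $t>0$. Fix $\varrho\in(0,1)$. For $N\ge1$ and $\mathbf i\in\{1,\dots,N\}^d$ let $O_{\mathbf i,N}=\prod_{n=1}^d\big(\frac{(2i_n-1)L_n}{2N}-\frac{\varrho L_n}{2N},\frac{(2i_n-1)L_n}{2N}+\frac{\varrho L_n}{2N}\big)$, let $\mathcal O_N$ be the span of the indicator functions $\mathbf 1_{O_{\mathbf i,N}}$, and $\beta_N=\inf\{\|Q\|_V^2/\|Q\|_H^2:Q\in V\cap\mathcal O_N^\perp,\ Q\ne0\}$, where $\perp$ is the orthogonal complement in $H$. The constant $c_\beta>0$ is independent of $N$ and satisfies $\beta_N\ge c_\beta N^2$ for all $N\ge 1$ (such a constant exists). Diffusion: $\nu(\omega,x)=\nu_0(x)+\exp\big(\sum_{j=1}^Mz_j(\omega)\psi_j(x)\big)$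 with $\psi_j\in L^\infty(D;\mathbb R)$, $\nu_0\in L^\infty(D;\mathbb R)$, $\underline\nu:=\operatorname{ess\,inf}_D\nu_0>0$, and $z_1,\dots,z_M$ real random variables with zero mean, pairwise uncorrelated and with bounded ranges. Set $\nu_{\min}(\omega)=\underline\nu+\exp\big(-\sum_{j=1}^M|z_j(\omega)|\|\psi_j\|_{L^\infty(D)}\big)$. "Failure" with $\bar N$ as actuator parameter means the event $\nu_{\min}^2(\omega)\beta_{\bar N}\le3c^2\mathcal N^2(a,b)$, i.e. the condition $\beta_{\bar N}>3c^2\mathcal N^2(a,b)/\nu_{\min}^2(\omega)$ guaranteeing stabilizability of the controlled parabolic equation $\partial_ty-\nabla\cdot(\nu\nabla y)+ay+\nabla\cdot(by)=\sum_{\mathbf i}u_{\mathbf i}\mathbf 1_{O_{\mathbf i,\bar N}}$ by the receding horizon control does not hold. *)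

theory Defs
  imports "HOL-Probability.Probability"
begin

text \<open>
  Elements of Lebesgue spaces are represented by Lebesgue measurable functions on the whole type,
  of which only the values on the underlying set \<open>S\<close> matter.
\<close>

definition in_Lp :: "'a::euclidean_space set \<Rightarrow> real \<Rightarrow> ('a \<Rightarrow> 'b::euclidean_space) \<Rightarrow> bool"
  where "in_Lp S p f \<longleftrightarrow>
    f \<in> borel_measurable (lebesgue_on S) \<and> integrable (lebesgue_on S) (\<lambda>x. norm (f x) powr p)"

definition Lp_norm :: "'a::euclidean_space set \<Rightarrow> real \<Rightarrow> ('a \<Rightarrow> 'b::euclidean_space) \<Rightarrow> real"
  where "Lp_norm S p f = (\<integral>x. norm (f x) powr p \<partial>lebesgue_on S) powr (1 / p)"

definition in_Linf :: "'a::euclidean_space set \<Rightarrow> ('a \<Rightarrow> 'b::euclidean_space) \<Rightarrow> bool"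
  where "in_Linf S f \<longleftrightarrow>
    f \<in> borel_measurable (lebesgue_on S) \<and> esssup (lebesgue_on S) (\<lambda>x. ereal (norm (f x))) < \<infinity>"

definition Linf_norm :: "'a::euclidean_space set \<Rightarrow> ('a \<Rightarrow> 'b::euclidean_space) \<Rightarrow> real"
  where "Linf_norm S f = real_of_ereal (esssup (lebesgue_on S) (\<lambda>x. ereal (norm (f x))))"

definition ess_inf :: "'a::euclidean_space set \<Rightarrow> ('a \<Rightarrow> real) \<Rightarrow> real"
  where "ess_inf S f = real_of_ereal (- esssup (lebesgue_on S) (\<lambda>x. ereal (- f x)))"

text \<open>
  For a finite exponent \<open>r\<close>, the (Bochner) space of essentially bounded functions of time with
  values in the separable space \<open>L\<^sup>r(D)\<close> consists of the jointly measurable functions whose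
  \<open>L\<^sup>r(D)\<close>-norm is essentially bounded in time.
\<close>

definition in_Linf_Lp :: "'a::euclidean_space set \<Rightarrow> real \<Rightarrow> (real \<Rightarrow> 'a \<Rightarrow> real) \<Rightarrow> bool"
  where "in_Linf_Lp D r a \<longleftrightarrow>
    (\<lambda>(t, x). a t x) \<in> borel_measurable (lebesgue_on ({0<..} \<times> D)) \<and>
    (AE t in lebesgue_on {0<..}. in_Lp D r (a t)) \<and>
    in_Linf {0<..} (\<lambda>t. Lp_norm D r (a t))"

definition coeff_norm ::
    "'a::euclidean_space set \<Rightarrow> real \<Rightarrow> (real \<Rightarrow> 'a \<Rightarrow> real) \<Rightarrow> (real \<Rightarrow> 'a \<Rightarrow> 'a) \<Rightarrow> real"
  where "coeff_norm D r a b =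
    Linf_norm {0<..} (\<lambda>t. Lp_norm D r (a t)) + Linf_norm ({0<..} \<times> D) (\<lambda>(t, x). b t x)"


primrec Ck :: "nat \<Rightarrow> ('a::euclidean_space \<Rightarrow> real) \<Rightarrow> bool"
  where
    "Ck 0 f = continuous_on UNIV f"
  | "Ck (Suc k) f = (\<exists>g. (\<forall>x. GDERIV f x :> g x) \<and> (\<forall>e\<in>Basis. Ck k (\<lambda>x. g x \<bullet> e)))"

definition test_function :: "'a::euclidean_space set \<Rightarrow> ('a \<Rightarrow> real) \<Rightarrow> bool"
  where "test_function D \<phi> \<longleftrightarrow>
    (\<forall>k. Ck k \<phi>) \<and> (\<exists>K. compact K \<and> K \<subseteq> D \<and> (\<forall>x. x \<notin> K \<longrightarrow> \<phi> x = 0))"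

definition grad :: "('a::euclidean_space \<Rightarrow> real) \<Rightarrow> 'a \<Rightarrow> 'a"
  where "grad \<phi> x = (THE g. GDERIV \<phi> x :> g)"

definition has_weak_grad :: "'a::euclidean_space set \<Rightarrow> ('a \<Rightarrow> real) \<Rightarrow> ('a \<Rightarrow> 'a) \<Rightarrow> bool"
  where "has_weak_grad D v g \<longleftrightarrow>
    in_Lp D 2 g \<and>
    (\<forall>\<phi>. test_function D \<phi> \<longrightarrow>
      (\<integral>x. v x *\<^sub>R grad \<phi> x \<partial>lebesgue_on D) = - (\<integral>x. \<phi> x *\<^sub>R g x \<partial>lebesgue_on D))"

text \<open>The weak gradient is determined only up to null sets; a representative is chosen.\<close>

definition weak_grad :: "'a::euclidean_space set \<Rightarrow> ('a \<Rightarrow> real) \<Rightarrow> 'a \<Rightarrow> 'a"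
  where "weak_grad D v = (SOME g. has_weak_grad D v g)"

definition H1 :: "'a::euclidean_space set \<Rightarrow> ('a \<Rightarrow> real) set"
  where "H1 D = {v. in_Lp D 2 v \<and> (\<exists>g. has_weak_grad D v g)}"

definition H01 :: "'a::euclidean_space set \<Rightarrow> ('a \<Rightarrow> real) set"
  where "H01 D = {v \<in> H1 D. \<exists>\<phi>. (\<forall>k::nat. test_function D (\<phi> k)) \<and>
    (\<lambda>k. Lp_norm D 2 (\<lambda>x. \<phi> k x - v x)) \<longlonglongrightarrow> 0 \<and>
    (\<lambda>k. Lp_norm D 2 (\<lambda>x. grad (\<phi> k) x - weak_grad D v x)) \<longlonglongrightarrow> 0}"

definition V_norm :: "'a::euclidean_space set \<Rightarrow> ('a \<Rightarrow> real) \<Rightarrow> real"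
  where "V_norm D v = Lp_norm D 2 (weak_grad D v)"


text \<open>
  The domain is \<open>box 0 L\<close>. The constant of the estimate for the reaction and convection terms
  depends on the domain only, so that the estimate is uniform in the exponent \<open>r\<close> and in the
  coefficients \<open>a\<close> and \<open>b\<close>. The duality pairing (with \<open>L\<^sup>2(D)\<close> as pivot space) of \<open>a(t) y\<close> with \<open>y\<close>
  is the integral of \<open>a(t) y y\<close>.
\<close>

definition reaction_convection_const :: "real ^ 'n \<Rightarrow> real \<Rightarrow> bool"
  where "reaction_convection_const L c \<longleftrightarrow> 0 < c \<and>
    (\<forall>r a b. real CARD('n) \<le> r \<longrightarrow> in_Linf_Lp (box 0 L) r a \<longrightarrow>
      in_Linf ({0<..} \<times> box 0 L) (\<lambda>(t, x). b t x) \<longrightarrow>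
      (AE t in lebesgue_on {0<..}. \<forall>y \<in> H01 (box 0 L).
        \<bar>\<integral>x. a t x * y x * y x \<partial>lebesgue_on (box 0 L)\<bar>
        + \<bar>\<integral>x. (y x *\<^sub>R b t x) \<bullet> weak_grad (box 0 L) y x \<partial>lebesgue_on (box 0 L)\<bar>
        \<le> c * coeff_norm (box 0 L) r a b * Lp_norm (box 0 L) 2 y * V_norm (box 0 L) y))"

definition actuator_domain :: "real ^ 'n \<Rightarrow> real \<Rightarrow> nat \<Rightarrow> ('n \<Rightarrow> nat) \<Rightarrow> (real ^ 'n) set"
  where "actuator_domain L \<rho> N i =
    box (\<chi> n. (2 * real (i n) - 1) * L $ n / (2 * real N) - \<rho> * L $ n / (2 * real N))
        (\<chi> n. (2 * real (i n) - 1) * L $ n / (2 * real N) + \<rho> * L $ n / (2 * real N))"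

text \<open>The linear span of the indicator functions of the actuator domains.\<close>

definition actuator_span :: "real ^ 'n \<Rightarrow> real \<Rightarrow> nat \<Rightarrow> (real ^ 'n \<Rightarrow> real) set"
  where "actuator_span L \<rho> N =
    {\<lambda>x. \<Sum>i \<in> {i. \<forall>n. i n \<in> {1..N}}. q i * indicator (actuator_domain L \<rho> N i) x | q. True}"

definition orth_compl :: "'a::euclidean_space set \<Rightarrow> ('a \<Rightarrow> real) set \<Rightarrow> ('a \<Rightarrow> real) set"
  where "orth_compl D A = {v. in_Lp D 2 v \<and> (\<forall>w\<in>A. (\<integral>x. v x * w x \<partial>lebesgue_on D) = 0)}"

definition beta :: "real ^ 'n \<Rightarrow> real \<Rightarrow> nat \<Rightarrow> real"
  where "beta L \<rho> N =
    Inf {(V_norm (box 0 L) Q)\<^sup>2 / (Lp_norm (box 0 L) 2 Q)\<^sup>2 | Q.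
      Q \<in> H01 (box 0 L) \<inter> orth_compl (box 0 L) (actuator_span L \<rho> N) \<and>
      \<not> (AE x in lebesgue_on (box 0 L). Q x = 0)}"


definition diffusion ::
    "('a \<Rightarrow> real) \<Rightarrow> (nat \<Rightarrow> 'a \<Rightarrow> real) \<Rightarrow> (nat \<Rightarrow> 'w \<Rightarrow> real) \<Rightarrow> nat \<Rightarrow> 'w \<Rightarrow> 'a \<Rightarrow> real"
  where "diffusion \<nu>0 \<psi> z m \<omega> x = \<nu>0 x + exp (\<Sum>j=1..m. z j \<omega> * \<psi> j x)"

definition Gam ::
    "'a::euclidean_space set \<Rightarrow> (nat \<Rightarrow> 'a \<Rightarrow> real) \<Rightarrow> (nat \<Rightarrow> 'w \<Rightarrow> real) \<Rightarrow> nat \<Rightarrow> 'w \<Rightarrow> real"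
  where "Gam D \<psi> z m \<omega> = (\<Sum>j=1..m. \<bar>z j \<omega>\<bar> * Linf_norm D (\<psi> j))"

definition nu_min ::
    "'a::euclidean_space set \<Rightarrow> ('a \<Rightarrow> real) \<Rightarrow> (nat \<Rightarrow> 'a \<Rightarrow> real) \<Rightarrow> (nat \<Rightarrow> 'w \<Rightarrow> real) \<Rightarrow> nat \<Rightarrow> 'w \<Rightarrow> real"
  where "nu_min D \<nu>0 \<psi> z m \<omega> = ess_inf D \<nu>0 + exp (- Gam D \<psi> z m \<omega>)"

definition failure_event :: "'w measure \<Rightarrow> ('w \<Rightarrow> real) \<Rightarrow> real \<Rightarrow> real \<Rightarrow> real \<Rightarrow> 'w set"
  where "failure_event P \<nu>min \<beta> c \<N> = {\<omega> \<in> space P. (\<nu>min \<omega>)\<^sup>2 * \<beta> \<le> 3 * c\<^sup>2 * \<N>\<^sup>2}"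

end

theory Submission
  imports Defs
begin

text \<open>
  Write \<open>\<delta> = sqrt 3 * c * \<N> / sqrt \<beta> - ess_inf D \<nu>0\<close>, where \<open>\<nu>0\<close> is the deterministic part of the
  diffusion. As all quantities are nonnegative, square roots may be taken in the failure inequality,
  which then says that \<open>exp (- \<Gamma>) \<le> \<delta>\<close>. So failure is impossible for negative \<open>\<delta>\<close>, and otherwise it
  is the event \<open>1 \<le> exp \<Gamma> \<cdot> \<delta>\<close>, whose probability is at most the expectation of \<open>exp \<Gamma> \<cdot> \<delta>\<close> by
  Markov's inequality. This expectation is finite because the random variables \<open>z\<^sub>j\<close>, hence also \<open>\<Gamma>\<close>,
  are bounded. The dependence on the number of actuators follows from \<open>\<beta>\<^sub>N \<ge> c\<^sub>\<beta> N\<^sup>2\<close>.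
\<close>

text \<open>
  The essential supremum is \<open>- \<infinity>\<close> over a null measure and \<open>\<infinity>\<close> for nonmeasurable functions; both are
  sent to \<open>0\<close>.
\<close>

lemma Linf_norm_nonneg: "0 \<le> Linf_norm S f"
proof -
  let ?M = "lebesgue_on S" and ?g = "\<lambda>x. ereal (norm (f x))"
  consider "?g \<notin> borel_measurable ?M" | "?g \<in> borel_measurable ?M" "emeasure ?M (space ?M) = 0"
    | "emeasure ?M (space ?M) \<noteq> 0" by blast
  then show ?thesis
  proof cases
    case 1
    then show ?thesis by (simp add: Linf_norm_def esssup_non_measurable top_ereal_def)
  next
    case 2
    then show ?thesis by (simp only: Linf_norm_def esssup_zero_space) simp
  next
    case 3
    then have "0 = esssup ?M (\<lambda>x. 0 :: ereal)" by (simp only: esssup_const not_False_eq_True)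
    also have "\<dots> \<le> esssup ?M ?g" by (rule esssup_mono) auto
    finally show ?thesis by (simp add: Linf_norm_def real_of_ereal_pos)
  qed
qed

lemma coeff_norm_nonneg: "0 \<le> coeff_norm D r a b"
  by (simp add: coeff_norm_def Linf_norm_nonneg)

lemma Gam_measurable:
  assumes "\<And>j. j \<in> {1..m} \<Longrightarrow> z j \<in> borel_measurable P"
  shows "Gam D \<psi> z m \<in> borel_measurable P"
  unfolding Gam_def using assms by (intro borel_measurable_sum) auto

lemma Gam_bounded:
  assumes "\<And>j. j \<in> {1..m} \<Longrightarrow> bounded (z j ` \<Omega>)"
  obtains B where "\<And>\<omega>. \<omega> \<in> \<Omega> \<Longrightarrow> Gam D \<psi> z m \<omega> \<le> B"
proof -
  have "\<forall>j\<in>{1..m}. \<exists>K. \<forall>\<omega>\<in>\<Omega>. \<bar>z j \<omega>\<bar> \<le> K"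
    using assms by (force simp: bounded_iff)
  then obtain K where K: "\<And>j \<omega>. j \<in> {1..m} \<Longrightarrow> \<omega> \<in> \<Omega> \<Longrightarrow> \<bar>z j \<omega>\<bar> \<le> K j"
    by metis
  show thesis
  proof (rule that)
    fix \<omega> assume "\<omega> \<in> \<Omega>"
    then show "Gam D \<psi> z m \<omega> \<le> (\<Sum>j=1..m. K j * Linf_norm D (\<psi> j))"
      unfolding Gam_def by (intro sum_mono mult_right_mono K Linf_norm_nonneg) auto
  qed
qed

lemma integrable_exp_Gam:
  assumes "prob_space P"
    and "\<And>j. j \<in> {1..m} \<Longrightarrow> z j \<in> borel_measurable P"
    and "\<And>j. j \<in> {1..m} \<Longrightarrow> bounded (z j ` space P)"
  shows "integrable P (\<lambda>\<omega>. exp (Gam D \<psi> z m \<omega>))"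
proof -
  interpret prob_space P by fact
  obtain B where B: "\<And>\<omega>. \<omega> \<in> space P \<Longrightarrow> Gam D \<psi> z m \<omega> \<le> B"
    by (rule Gam_bounded[of m z "space P" D \<psi>]) (use assms(3) in auto)
  have "Gam D \<psi> z m \<in> borel_measurable P"
    using assms(2) by (rule Gam_measurable)
  then show ?thesis
    by (intro integrable_const_bound[where B = "exp B"] AE_I2) (auto simp: B)
qed

lemma failure_event_imp_exp_le:
  assumes "0 < \<beta>" "0 \<le> c" "0 \<le> \<N>" "0 < ess_inf D \<nu>0"
    and "\<omega> \<in> failure_event P (nu_min D \<nu>0 \<psi> z m) \<beta> c \<N>"
  shows "exp (- Gam D \<psi> z m \<omega>) \<le> sqrt 3 * c * \<N> * \<beta> powr (- 1 / 2) - ess_inf D \<nu>0"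
proof -
  have "(nu_min D \<nu>0 \<psi> z m \<omega> * sqrt \<beta>)\<^sup>2 \<le> (sqrt 3 * c * \<N>)\<^sup>2"
    using assms by (simp add: failure_event_def power_mult_distrib)
  then have "nu_min D \<nu>0 \<psi> z m \<omega> * sqrt \<beta> \<le> sqrt 3 * c * \<N>"
    by (rule power2_le_imp_le) (use assms in simp)
  then have "nu_min D \<nu>0 \<psi> z m \<omega> \<le> sqrt 3 * c * \<N> / sqrt \<beta>"
    using assms(1) by (simp add: pos_le_divide_eq)
  also have "\<dots> = sqrt 3 * c * \<N> * \<beta> powr (- 1 / 2)"
    using assms(1) by (simp add: powr_minus powr_half_sqrt field_simps)
  finally show ?thesis by (simp add: nu_min_def)
qed

text \<open>
  This is Markov's inequality at the threshold \<open>1 / \<delta>\<close>, multiplied out so that \<open>\<delta> = 0\<close> is covered;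
  it holds since \<open>f x * \<delta>\<close> dominates the indicator function of \<open>A\<close>.
\<close>

lemma (in finite_measure) measure_le_integral_times:
  fixes f :: "'a \<Rightarrow> real"
  assumes f: "integrable M f" "\<And>x. x \<in> space M \<Longrightarrow> 0 \<le> f x" and "0 \<le> \<delta>"
    and A: "A \<in> sets M" "\<And>x. x \<in> A \<Longrightarrow> 1 \<le> f x * \<delta>"
  shows "measure M A \<le> (\<integral>x. f x \<partial>M) * \<delta>"
proof -
  have "measure M A = (\<integral>x. indicator A x \<partial>M)"
    using A(1) by simp
  also have "\<dots> \<le> (\<integral>x. f x * \<delta> \<partial>M)"
    using assms
    by (intro integral_mono integrable_mult_left integrable_real_indicator)
       (auto simp: indicator_def less_top[symmetric])
  finally show ?thesis by simp
qed

lemma powr_minus_half_le: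
  fixes \<beta> C x :: real
  assumes "0 < C" "0 < x" "C * x\<^sup>2 \<le> \<beta>"
  shows "sqrt 3 * \<beta> powr (- 1 / 2) \<le> (3 / C) powr (1 / 2) * inverse x"
proof -
  have pos: "0 < C * x\<^sup>2" using assms by simp
  have "sqrt 3 * \<beta> powr (- 1 / 2) \<le> sqrt 3 * (C * x\<^sup>2) powr (- 1 / 2)"
    using pos assms(3) by (intro mult_left_mono powr_mono2') auto
  also have "\<dots> = (3 / C) powr (1 / 2) * inverse x"
    using assms(1,2) pos
    by (simp add: powr_minus powr_half_sqrt real_sqrt_mult real_sqrt_divide field_simps)
  finally show ?thesis .
qed

theorem mainTheorem6:
  fixes L :: "real ^ 'n" and D :: "(real ^ 'n) set"
    and r c c\<^sub>\<beta> \<rho> \<N> :: real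
    and a :: "real \<Rightarrow> real ^ 'n \<Rightarrow> real"
    and b :: "real \<Rightarrow> real ^ 'n \<Rightarrow> real ^ 'n"
    and P :: "'w measure"
    and \<nu> :: "'w \<Rightarrow> real ^ 'n \<Rightarrow> real"
    and \<nu>0 :: "real ^ 'n \<Rightarrow> real"
    and \<psi> :: "nat \<Rightarrow> real ^ 'n \<Rightarrow> real"
    and z :: "nat \<Rightarrow> 'w \<Rightarrow> real"
    and m Nbar :: nat
  assumes L_pos: "\<And>n. 0 < L $ n"
    and D: "D = box 0 L"
    and r: "real CARD('n) \<le> r"
    and a: "in_Linf_Lp D r a"
    and b: "in_Linf ({0<..} \<times> D) (\<lambda>(t, x). b t x)"
    and N: "\<N> = coeff_norm D r a b"
    and c: "reaction_convection_const L c"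
    and \<rho>: "0 < \<rho>" "\<rho> < 1"
    and c\<beta>: "0 < c\<^sub>\<beta>" "\<And>N. 1 \<le> N \<Longrightarrow> beta L \<rho> N \<ge> c\<^sub>\<beta> * (real N)\<^sup>2"
    and P: "prob_space P" "complete_measure P"
    and \<nu>0: "in_Linf D \<nu>0" "0 < ess_inf D \<nu>0"
    and \<psi>: "\<And>j. j \<in> {1..m} \<Longrightarrow> in_Linf D (\<psi> j)"
    and z_rv: "\<And>j. j \<in> {1..m} \<Longrightarrow> z j \<in> borel_measurable P"
    and z_bounded: "\<And>j. j \<in> {1..m} \<Longrightarrow> bounded (z j ` space P)"
    and z_mean: "\<And>j. j \<in> {1..m} \<Longrightarrow> (\<integral>\<omega>. z j \<omega> \<partial>P) = 0"
    and z_uncorrelated: "\<And>j k. j \<in> {1..m} \<Longrightarrow> k \<in> {1..m} \<Longrightarrow> j \<noteq> k \<Longrightarrow>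
      (\<integral>\<omega>. z j \<omega> * z k \<omega> \<partial>P) = (\<integral>\<omega>. z j \<omega> \<partial>P) * (\<integral>\<omega>. z k \<omega> \<partial>P)"
    and \<nu>: "\<And>\<omega>. \<omega> \<in> space P \<Longrightarrow> AE x in lebesgue_on D. \<nu> \<omega> x = diffusion \<nu>0 \<psi> z m \<omega> x"
    and Nbar: "1 \<le> Nbar"
    and wlog: "sqrt (beta L \<rho> Nbar) * (1 + ess_inf D \<nu>0) \<ge> sqrt 3 * c * \<N>"
  shows
    "integrable P (\<lambda>\<omega>. exp (Gam D \<psi> z m \<omega>)) \<and>
     (sqrt 3 * c * \<N> * beta L \<rho> Nbar powr (- 1 / 2) - ess_inf D \<nu>0 < 0 \<longrightarrow>
       failure_event P (nu_min D \<nu>0 \<psi> z m) (beta L \<rho> Nbar) c \<N> = {}) \<and>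
     (sqrt 3 * c * \<N> * beta L \<rho> Nbar powr (- 1 / 2) - ess_inf D \<nu>0 \<ge> 0 \<longrightarrow>
       measure P (failure_event P (nu_min D \<nu>0 \<psi> z m) (beta L \<rho> Nbar) c \<N>)
       \<le> (\<integral>\<omega>. exp (Gam D \<psi> z m \<omega>) \<partial>P)
          * (sqrt 3 * c * \<N> * beta L \<rho> Nbar powr (- 1 / 2) - ess_inf D \<nu>0)) \<and>
     (\<integral>\<omega>. exp (Gam D \<psi> z m \<omega>) \<partial>P)
       * (sqrt 3 * c * \<N> * beta L \<rho> Nbar powr (- 1 / 2) - ess_inf D \<nu>0)
     \<le> (\<integral>\<omega>. exp (Gam D \<psi> z m \<omega>) \<partial>P)
       * ((3 / c\<^sub>\<beta>) powr (1 / 2) * c * \<N> * inverse (real Nbar) - ess_inf D \<nu>0)"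
proof -
  interpret prob_space P by fact
  define G where "G = Gam D \<psi> z m"
  define \<beta> where "\<beta> = beta L \<rho> Nbar"
  define \<delta> where "\<delta> = sqrt 3 * c * \<N> * \<beta> powr (- 1 / 2) - ess_inf D \<nu>0"
  define F where "F = failure_event P (nu_min D \<nu>0 \<psi> z m) \<beta> c \<N>"
  have \<beta>: "c\<^sub>\<beta> * (real Nbar)\<^sup>2 \<le> \<beta>"
    unfolding \<beta>_def using c\<beta>(2) Nbar .
  have "0 < c\<^sub>\<beta> * (real Nbar)\<^sup>2" using c\<beta>(1) Nbar by simp
  with \<beta> have \<beta>_pos: "0 < \<beta>" by linarith
  have c_pos: "0 < c" using c by (simp add: reaction_convection_const_def)
  have \<N>_nonneg: "0 \<le> \<N>" by (simp add: N coeff_norm_nonneg)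
  have int: "integrable P (\<lambda>\<omega>. exp (G \<omega>))"
    unfolding G_def using P(1) z_rv z_bounded by (rule integrable_exp_Gam)
  have F_exp: "exp (- G \<omega>) \<le> \<delta>" if "\<omega> \<in> F" for \<omega>
    using failure_event_imp_exp_le[OF \<beta>_pos less_imp_le[OF c_pos] \<N>_nonneg \<nu>0(2)] that
    by (simp add: F_def G_def \<delta>_def)

  have empty: "F = {}" if "\<delta> < 0"
  proof -
    have "\<omega> \<notin> F" for \<omega>
      using F_exp[of \<omega>] that exp_gt_zero[of "- G \<omega>"] by linarith
    then show ?thesis by blast
  qed

  have markov: "measure P F \<le> (\<integral>\<omega>. exp (G \<omega>) \<partial>P) * \<delta>" if "0 \<le> \<delta>"
  proof (rule measure_le_integral_times[OF int _ that])
    have [measurable]: "Gam D \<psi> z m \<in> borel_measurable P"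
      using z_rv by (rule Gam_measurable)
    show "F \<in> sets P"
      unfolding F_def failure_event_def nu_min_def by measurable
    show "1 \<le> exp (G \<omega>) * \<delta>" if "\<omega> \<in> F" for \<omega>
      using mult_left_mono[OF F_exp[OF that], of "exp (G \<omega>)"] by (simp add: exp_minus)
  qed simp

  have "sqrt 3 * \<beta> powr (- 1 / 2) * (c * \<N>)
      \<le> (3 / c\<^sub>\<beta>) powr (1 / 2) * inverse (real Nbar) * (c * \<N>)"
    using c\<beta>(1) Nbar \<beta> c_pos \<N>_nonneg by (intro mult_right_mono powr_minus_half_le) auto
  then have "\<delta> \<le> (3 / c\<^sub>\<beta>) powr (1 / 2) * c * \<N> * inverse (real Nbar) - ess_inf D \<nu>0"
    by (simp add: \<delta>_def mult_ac)
  then have "(\<integral>\<omega>. exp (G \<omega>) \<partial>P) * \<delta> \<le> (\<integral>\<omega>. exp (G \<omega>) \<partial>P)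
      * ((3 / c\<^sub>\<beta>) powr (1 / 2) * c * \<N> * inverse (real Nbar) - ess_inf D \<nu>0)"
    by (intro mult_left_mono) auto
  with int empty markov show ?thesis
    unfolding F_def G_def \<delta>_def \<beta>_def by blast
qed

end
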